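(* Let $k\ge1$, let $G=(V,E)$ be a finite $(k+1)$-claw free graph with positive vertex weights $w$, let $O$ be a maximum-weight independent set of $G$ and let $A$ be an independent set of $G$ with $N(o,A)\neq\emptyset$ for all $o\in O$. For any $0\le\epsilon\le 1/2$, if $A$ is locally optimal under $s$-exchanges for some $s\ge 1+k(k-1)$, then $$w(O)\le\left[\frac{k+1}{2}-\frac12\min\left\{\frac{1-\epsilon}{2-\epsilon},\ \rho_k\right\}\right]w(A),$$ where $\rho_k=\big(k-1/\sqrt{1-\epsilon}\big)\big(1-\sqrt{1-\epsilon}\big)$.
   Context: A graph is $(k+1)$-claw free if it has no induced subgraph consisting of a vertex adjacent to $k+1$ pairwise non-adjacent vertices. For $X\subseteq V$, $w(X)=\sum_{v\in X}w_v$, $w^2(X)=\sum_{v\in X}w_v^2$. For $X,Y\subseteq V$, $N(X,Y)=\{y\in Y: y\text{ adjacent to some }x\in X\}\cup(X\cap Y)$, $N(v,Y)=N(\{v\},Y)$, and $A-a=A\setminus\{a\}$. For $o\in O$, $\pi(o)$ is a vertex of $N(o,A)$ of maximum weight (ties broken arbitrarily but consistently). For $a\in A$: $C_a=\{o\in O:\pi(o)=a\}$ and $N^+_a=\{a\}\cup\bigcup_{o\in C_a}N(o,A-a)$. $A$ is locally optimal under $s$-exchanges if for every $X\subseteq A$ with $1\le|X|\le s$, $w^2\big(\bigcup_{x\in X}C_x\big)\le w^2\big(\bigcup_{x\in X}N^+_x\big)$. *)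

theory Defs
  imports Complex_Main "Graph_Theory.Digraph_Component"
begin

text \<open>
  A finite simple graph is a symmetric, loop-free digraph without parallel arcs on a finite
  vertex set (locale \<open>graph\<close>); adjacency is \<open>u \<rightarrow>\<^bsub>G\<^esub> v\<close>.
\<close>

definition pairwise_nonadj :: "('a, 'b) pre_digraph \<Rightarrow> 'a set \<Rightarrow> bool" where
  "pairwise_nonadj G T \<longleftrightarrow> (\<forall>u\<in>T. \<forall>v\<in>T. u \<noteq> v \<longrightarrow> \<not> u \<rightarrow>\<^bsub>G\<^esub> v)"

definition indep_set :: "('a, 'b) pre_digraph \<Rightarrow> 'a set \<Rightarrow> bool" where
  "indep_set G S \<longleftrightarrow> S \<subseteq> verts G \<and> pairwise_nonadj G S"

text \<open>A \<open>d\<close>-claw: a centre \<open>c\<close> adjacent to \<open>d\<close> pairwise non-adjacent vertices (the talons \<open>T\<close>).\<close>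

definition is_claw :: "nat \<Rightarrow> ('a, 'b) pre_digraph \<Rightarrow> bool" where
  "is_claw d H \<longleftrightarrow> (\<exists>c T. verts H = insert c T \<and> c \<notin> T \<and> finite T \<and> card T = d \<and>
     (\<forall>t\<in>T. c \<rightarrow>\<^bsub>H\<^esub> t) \<and> pairwise_nonadj H T)"

definition claw_free :: "nat \<Rightarrow> ('a, 'b) pre_digraph \<Rightarrow> bool" where
  "claw_free d G \<longleftrightarrow> \<not> (\<exists>H. induced_subgraph H G \<and> is_claw d H)"

lemma claw_free_iff:
  assumes "graph G"
  shows "claw_free d G \<longleftrightarrow>
    (\<forall>c T. finite T \<longrightarrow> card T = d \<longrightarrow> c \<in> verts G \<longrightarrow> (\<forall>t\<in>T. c \<rightarrow>\<^bsub>G\<^esub> t) \<longrightarrow>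
       \<not> pairwise_nonadj G T)"
proof -
  interpret graph G by fact
  have adj: "u \<rightarrow>\<^bsub>H\<^esub> v \<longleftrightarrow> u \<rightarrow>\<^bsub>G\<^esub> v"
    if "induced_subgraph H G" "u \<in> verts H" "v \<in> verts H" for H :: "('a, 'b) pre_digraph" and u v
    using that by (auto simp: induced_subgraph_def subgraph_def compatible_def arcs_ends_conv)
  show ?thesis
  proof
    assume cf: "claw_free d G"
    show "\<forall>c T. finite T \<longrightarrow> card T = d \<longrightarrow> c \<in> verts G \<longrightarrow> (\<forall>t\<in>T. c \<rightarrow>\<^bsub>G\<^esub> t) \<longrightarrow>
       \<not> pairwise_nonadj G T"
    proof (intro allI impI notI)
      fix c T
      assume T: "finite T" "card T = d" "c \<in> verts G" "\<forall>t\<in>T. c \<rightarrow>\<^bsub>G\<^esub> t" "pairwise_nonadj G T"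
      define H where "H = G \<restriction> insert c T"
      have ind: "induced_subgraph H G"
        unfolding H_def by (rule induced_induce) (use T adj_in_verts in blast)
      have vH: "verts H = insert c T" by (simp add: H_def)
      have "c \<notin> T" using T(4) adj_not_same by blast
      moreover have "\<forall>t\<in>T. c \<rightarrow>\<^bsub>H\<^esub> t" using T(4) adj[OF ind] vH by auto
      moreover have "pairwise_nonadj H T"
        using T(5) adj[OF ind] vH by (auto simp: pairwise_nonadj_def)
      ultimately have "is_claw d H" unfolding is_claw_def using vH T(1,2) by blast
      with ind cf show False by (auto simp: claw_free_def)
    qed
  next
    assume no: "\<forall>c T. finite T \<longrightarrow> card T = d \<longrightarrow> c \<in> verts G \<longrightarrow> (\<forall>t\<in>T. c \<rightarrow>\<^bsub>G\<^esub> t) \<longrightarrow>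
       \<not> pairwise_nonadj G T"
    show "claw_free d G"
      unfolding claw_free_def
    proof
      assume "\<exists>H. induced_subgraph H G \<and> is_claw d H"
      then obtain H c T where H: "induced_subgraph H G" "verts H = insert c T" "finite T"
        "card T = d" "\<forall>t\<in>T. c \<rightarrow>\<^bsub>H\<^esub> t" "pairwise_nonadj H T"
        unfolding is_claw_def by blast
      have "c \<in> verts G" using H(1,2) by (auto simp: induced_subgraph_def subgraph_def)
      moreover have "\<forall>t\<in>T. c \<rightarrow>\<^bsub>G\<^esub> t" using H(2,5) adj[OF H(1)] by auto
      moreover have "pairwise_nonadj G T"
        using H(2,6) adj[OF H(1)] by (auto simp: pairwise_nonadj_def)
      ultimately show False using no H(3,4) by blast
    qed
  qed
qed

definition wt :: "('a \<Rightarrow> real) \<Rightarrow> 'a set \<Rightarrow> real" where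
  "wt w X = (\<Sum>v\<in>X. w v)"

definition wt2 :: "('a \<Rightarrow> real) \<Rightarrow> 'a set \<Rightarrow> real" where
  "wt2 w X = (\<Sum>v\<in>X. (w v)\<^sup>2)"

definition max_weight_indep_set :: "('a, 'b) pre_digraph \<Rightarrow> ('a \<Rightarrow> real) \<Rightarrow> 'a set \<Rightarrow> bool" where
  "max_weight_indep_set G w S \<longleftrightarrow> is_arg_max (wt w) (indep_set G) S"

definition nbhd :: "('a, 'b) pre_digraph \<Rightarrow> 'a set \<Rightarrow> 'a set \<Rightarrow> 'a set" where
  "nbhd G X Y = {y \<in> Y. \<exists>x\<in>X. x \<rightarrow>\<^bsub>G\<^esub> y} \<union> (X \<inter> Y)"

text \<open>
  \<open>\<pi>\<close> picks for every \<open>u \<in> Opt\<close> a heaviest vertex of \<open>N(u, A)\<close>; any choice among ties is allowed.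
\<close>

definition heaviest_nbr_map ::
    "('a, 'b) pre_digraph \<Rightarrow> ('a \<Rightarrow> real) \<Rightarrow> 'a set \<Rightarrow> 'a set \<Rightarrow> ('a \<Rightarrow> 'a) \<Rightarrow> bool" where
  "heaviest_nbr_map G w Opt A \<pi> \<longleftrightarrow>
     (\<forall>u\<in>Opt. is_arg_max w (\<lambda>a. a \<in> nbhd G {u} A) (\<pi> u))"

definition charged :: "'a set \<Rightarrow> ('a \<Rightarrow> 'a) \<Rightarrow> 'a \<Rightarrow> 'a set" where
  "charged Opt \<pi> a = {u \<in> Opt. \<pi> u = a}"

definition nbhd_plus ::
    "('a, 'b) pre_digraph \<Rightarrow> 'a set \<Rightarrow> 'a set \<Rightarrow> ('a \<Rightarrow> 'a) \<Rightarrow> 'a \<Rightarrow> 'a set" where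
  "nbhd_plus G Opt A \<pi> a = {a} \<union> (\<Union>u\<in>charged Opt \<pi> a. nbhd G {u} (A - {a}))"

definition locally_optimal ::
    "('a, 'b) pre_digraph \<Rightarrow> ('a \<Rightarrow> real) \<Rightarrow> 'a set \<Rightarrow> ('a \<Rightarrow> 'a) \<Rightarrow> nat \<Rightarrow> 'a set \<Rightarrow> bool" where
  "locally_optimal G w Opt \<pi> s A \<longleftrightarrow>
     (\<forall>X. X \<subseteq> A \<longrightarrow> 1 \<le> card X \<longrightarrow> card X \<le> s \<longrightarrow>
        wt2 w (\<Union>x\<in>X. charged Opt \<pi> x) \<le> wt2 w (\<Union>x\<in>X. nbhd_plus G Opt A \<pi> x))"

definition rho :: "nat \<Rightarrow> real \<Rightarrow> real" where
  "rho k \<epsilon> = (real k - 1 / sqrt (1 - \<epsilon>)) * (1 - sqrt (1 - \<epsilon>))"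

end

theory Submission
  imports Defs
begin

text \<open>
  Write \<open>D a = w\<^sup>2(C\<^sub>a) - (\<Sum>u\<in>C\<^sub>a. w\<^sup>2(N(u, A - a)))\<close>, so that local optimality at \<open>{a}\<close> yields
  \<open>D a \<le> w\<^sub>a\<^sup>2\<close> and hence Berman's bound \<open>2 w(Opt) \<le> (k + 1) w(A)\<close>.
  For \<open>u \<in> Opt\<close> with \<open>p = w(\<pi> u)\<close>, every \<open>x \<in> N(u, A) - \<pi> u\<close> leaves a slack \<open>w\<^sub>x - w\<^sub>x\<^sup>2 / p\<close> in
  that argument. Put \<open>c = sqrt (1 - \<epsilon>)\<close> and call \<open>x\<close> close to \<open>\<pi> u\<close> if \<open>w\<^sub>x \<ge> c\<^sup>2 p\<close>.

  The vertices of \<open>A\<close> that are close to another one are partitioned into stars. All vertices of a star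
  are exchanged at once: a vertex of \<open>A\<close> that several of the sets \<open>N\<^sup>+\<close> share is
  paid for only once, which saves the fraction \<open>c\<^sup>2 / (1 + c\<^sup>2)\<close> of the weight of the star.
  At a vertex without close partners all slacks are large. Dividing the slack of a pair that is not
  close between \<open>x\<close> (which receives \<open>w\<^sub>x - w\<^sub>x\<^sup>2 / (c p)\<close>, called
  \<open>down\<close> below) and \<open>\<pi> u\<close> (which receives the rest, called \<open>up\<close>) saves the fraction \<open>\<rho>\<^sub>k\<close>.
\<close>

subsection \<open>Partition into stars\<close>

text \<open>Leaves may be related to one another. A star with at least two leaves therefore stays a
  star when one leaf is removed.\<close>

definition is_star :: "('a \<Rightarrow> 'a \<Rightarrow> bool) \<Rightarrow> 'a set \<Rightarrow> bool" where
  "is_star E X \<longleftrightarrow> (\<exists>c L. X = insert c L \<and> c \<notin> L \<and> L \<noteq> {} \<and> (\<forall>x\<in>L. E c x))"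

text \<open>The position of \<open>u\<close> decides. If \<open>u\<close> is uncovered,
  \<open>{u, v}\<close> is a new star. If \<open>u\<close> is a centre, \<open>v\<close> becomes a
  further leaf. If \<open>u\<close> is the only leaf, its star is recentred at \<open>u\<close>. If
  \<open>u\<close> is one of several leaves, it leaves its star and forms \<open>{u, v}\<close>. No
  vertex loses its cover.\<close>

lemma star_cover_extend:
  assumes P: "\<forall>X\<in>P. is_star E X" "disjoint P"
    and sym: "\<And>x y. E x y \<Longrightarrow> E y x" and "E v u" "v \<noteq> u" "v \<notin> \<Union>P"
  obtains Q where "\<forall>X\<in>Q. is_star E X" "disjoint Q" "\<Union>Q = insert v (insert u (\<Union>P))"
proof (cases "u \<in> \<Union>P")
  case False
  have "is_star E {u, v}"
    unfolding is_star_def using assms by (intro exI[of _ u] exI[of _ "{v}"]) auto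
  then show ?thesis
    using False assms by (intro that[of "insert {u, v} P"]) (auto simp: disjoint_def)
next
  case True
  note result = that
  obtain X where X: "X \<in> P" "u \<in> X" using True by blast
  from X(1) P(1) obtain c L where cL: "X = insert c L" "c \<notin> L" "L \<noteq> {}" "\<forall>x\<in>L. E c x"
    unfolding is_star_def by blast
  have disj: "disjoint (P - {X})" "\<forall>Y\<in>P - {X}. Y \<inter> X = {}"
    using P(2) X(1) by (auto simp: disjoint_def)
  have PX: "\<Union>P = \<Union>(P - {X}) \<union> X" using X(1) by blast
  have ?thesis if st: "is_star E (insert v X)"
  proof (rule result[of "insert (insert v X) (P - {X})"], goal_cases)
    case 1 show ?case using P(1) st by blast
  next
    case 2
    have "\<forall>Y\<in>P - {X}. Y \<inter> insert v X = {}" using disj(2) assms(6) by blast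
    then show ?case using disj(1) by (auto simp: disjoint_def)
  next
    case 3 show ?case using PX X(2) by blast
  qed
  moreover have "is_star E (insert v X)" if "u = c"
    unfolding is_star_def using that cL assms X(1)
    by (intro exI[of _ c] exI[of _ "insert v L"]) auto
  moreover have "is_star E (insert v X)" if "L = {u}"
    unfolding is_star_def using that cL assms X
    by (intro exI[of _ u] exI[of _ "{c, v}"]) auto
  moreover have ?thesis if "u \<in> L" "L \<noteq> {u}"
  proof (rule result[of "insert (X - {u}) (insert {u, v} (P - {X}))"], goal_cases)
    case 1
    have "is_star E (X - {u})"
      unfolding is_star_def using that cL
      by (intro exI[of _ c] exI[of _ "L - {u}"]) auto
    moreover have "is_star E {u, v}"
      unfolding is_star_def using assms by (intro exI[of _ u] exI[of _ "{v}"]) auto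
    ultimately show ?case using P(1) by blast
  next
    case 2
    have "\<forall>Y\<in>P - {X}. Y \<inter> {u, v} = {} \<and> Y \<inter> (X - {u}) = {}" "(X - {u}) \<inter> {u, v} = {}"
      using disj(2) assms(6) X by blast+
    then show ?case using disj(1) unfolding disjoint_def by (auto simp: Int_commute)
  next
    case 3 show ?case using PX X(2) by blast
  qed
  ultimately show ?thesis using X(2) cL(1) by blast
qed

text \<open>A largest subset of \<open>A\<close> that splits into stars is all of \<open>A\<close>,
  since \<open>star_cover_extend\<close> would enlarge any smaller one.\<close>

lemma star_partition:
  assumes "finite A" and sym: "\<And>x y. E x y \<Longrightarrow> E y x" and irrefl: "\<And>x. \<not> E x x"
    and cov: "\<And>x. x \<in> A \<Longrightarrow> \<exists>y\<in>A. E x y"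
  obtains P where "\<forall>X\<in>P. is_star E X" "disjoint P" "\<Union>P = A"
proof -
  define cand where
    "cand = (\<lambda>U. U \<subseteq> A \<and> (\<exists>P. (\<forall>X\<in>P. is_star E X) \<and> disjoint P \<and> \<Union>P = U))"
  have "cand {}" unfolding cand_def by (auto intro!: exI[of _ "{}"] simp: disjoint_def)
  moreover have "\<forall>U. cand U \<longrightarrow> card U < Suc (card A)"
    unfolding cand_def using card_mono[OF \<open>finite A\<close>] by (auto simp: less_Suc_eq_le)
  ultimately obtain U where U: "cand U" "\<And>U'. cand U' \<Longrightarrow> card U' \<le> card U"
    using ex_has_greatest_nat[of cand "{}" card "Suc (card A)"] by blast
  from U(1) obtain P where P: "\<forall>X\<in>P. is_star E X" "disjoint P" "\<Union>P = U" "U \<subseteq> A"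
    unfolding cand_def by blast
  have "A \<subseteq> U"
  proof
    fix v assume v: "v \<in> A"
    show "v \<in> U"
    proof (rule ccontr)
      assume nv: "v \<notin> U"
      obtain u where u: "u \<in> A" "E v u" using cov[OF v] by blast
      with irrefl have "v \<noteq> u" by blast
      obtain Q where Q: "\<forall>X\<in>Q. is_star E X" "disjoint Q" "\<Union>Q = insert v (insert u U)"
        using star_cover_extend[OF P(1,2) sym u(2) \<open>v \<noteq> u\<close>] nv P(3) by metis
      then have "cand (insert v (insert u U))"
        unfolding cand_def using v u(1) P(4) by blast
      \<comment> \<open>\<open>u\<close> may be covered already, so the strict growth has to come
        from \<open>v\<close>.\<close>
      from U(2)[OF this] have "card (insert v (insert u U)) \<le> card U" .
      moreover have "finite U" using P(4) \<open>finite A\<close> finite_subset by blast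
      then have "card U \<le> card (insert u U)"
        by (intro card_mono) auto
      ultimately show False using nv \<open>finite U\<close> \<open>v \<noteq> u\<close> by (auto simp: card_insert_if split: if_splits)
    qed
  qed
  with P show ?thesis using that by blast
qed

subsection \<open>Charging the weight of the optimum\<close>

lemma wt2_mono: "finite Y \<Longrightarrow> X \<subseteq> Y \<Longrightarrow> wt2 w X \<le> wt2 w Y"
  by (simp add: wt2_def sum_mono2)

lemma wt2_Un_le: "finite X \<Longrightarrow> finite Y \<Longrightarrow> wt2 w (X \<union> Y) \<le> wt2 w X + wt2 w Y"
  unfolding wt2_def by (simp add: sum_Un sum_nonneg)

lemma wt2_UN_le:
  assumes "finite I" "\<And>i. i \<in> I \<Longrightarrow> finite (F i)"
  shows "wt2 w (\<Union>i\<in>I. F i) \<le> (\<Sum>i\<in>I. wt2 w (F i))"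
  using assms
proof (induction I rule: finite_induct)
  case (insert i I)
  have "wt2 w (F i \<union> (\<Union>j\<in>I. F j)) \<le> wt2 w (F i) + wt2 w (\<Union>j\<in>I. F j)"
    using insert by (intro wt2_Un_le) auto
  also have "wt2 w (\<Union>j\<in>I. F j) \<le> (\<Sum>j\<in>I. wt2 w (F j))"
    using insert by auto
  finally show ?case using insert(1,2) by simp
qed (simp add: wt2_def)

section \<open>The weight inequality for a single star\<close>

text \<open>Here \<alpha> is the weight of the centre, \<open>B\<close> and \<open>Y\<close> are the
  heavier and the lighter leaves, and \<open>M\<close> is the largest weight in the star. Each
  summand is the slack of an edge plus what the joint exchange saves on it. Every leaf covers its
  own share of the left-hand side, and one well-chosen leaf has enough left over for the
  centre.\<close>

lemma star_slack_lower:
  fixes y :: "'a \<Rightarrow> real"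
  assumes g: "0 < g" "g \<le> 1" and \<alpha>: "0 < \<alpha>" "\<alpha> \<le> M" "g * M \<le> \<alpha>"
    and fin: "finite B" "finite Y"
    and B: "\<And>b. b \<in> B \<Longrightarrow> \<alpha> \<le> y b \<and> y b \<le> M"
    and Y: "\<And>x. x \<in> Y \<Longrightarrow> g * \<alpha> \<le> y x \<and> y x \<le> \<alpha>"
    and M: "(M = \<alpha> \<and> Y \<noteq> {}) \<or> (\<exists>b\<in>B. y b = M)"
  shows "g / (1 + g) * (\<alpha> + (\<Sum>b\<in>B. y b) + (\<Sum>x\<in>Y. y x))
    \<le> (\<Sum>b\<in>B. \<alpha> - \<alpha>\<^sup>2 / y b + \<alpha>\<^sup>2 / M) + (\<Sum>x\<in>Y. y x - (y x)\<^sup>2 / \<alpha> + (y x)\<^sup>2 / M)"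
proof -
  define \<mu> where "\<mu> = g / (1 + g)"
  \<comment> \<open>The value of \<mu> is the solution of \<mu> = g (1 - \<mu>), which makes both
    cases for the centre balance.\<close>
  have \<mu>: "0 < \<mu>" "\<mu> \<le> g" "\<mu> * g = g - \<mu>"
    using g by (auto simp: \<mu>_def field_simps)
  have M0: "M > 0" using \<alpha> by linarith
  have \<mu>M: "\<mu> * M \<le> \<alpha>"
    using mult_right_mono[OF \<mu>(2), of M] M0 \<alpha>(3) by linarith
  define fB where "fB = (\<lambda>b. \<alpha> - \<alpha>\<^sup>2 / y b + \<alpha>\<^sup>2 / M - \<mu> * y b)"
  define fY where "fY = (\<lambda>x. y x - (y x)\<^sup>2 / \<alpha> + (y x)\<^sup>2 / M - \<mu> * y x)"
  have posB: "0 \<le> fB b" if "b \<in> B" for b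
  proof -
    have b: "\<alpha> \<le> y b" "y b \<le> M" using B[OF that] by auto
    then have b0: "0 < y b" using \<alpha> by linarith
    \<comment> \<open>As a function of \<open>y b\<close> the summand is concave and meets the line
      \<open>\<alpha> * y b / M\<close> at \<alpha> and at \<open>M\<close>, so it lies above that
      line in between.\<close>
    have "0 \<le> (y b - \<alpha>) * (M - y b)" using b by simp
    then have "0 \<le> \<alpha> * ((y b - \<alpha>) * (M - y b)) / (y b * M)" using \<alpha> b0 M0 by simp
    also have "\<dots> = \<alpha> - \<alpha>\<^sup>2 / y b + \<alpha>\<^sup>2 / M - \<alpha> * y b / M"
      using b0 M0 by (simp add: field_simps power2_eq_square)
    finally have "\<alpha> * y b / M \<le> \<alpha> - \<alpha>\<^sup>2 / y b + \<alpha>\<^sup>2 / M" by simp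
    moreover have "\<mu> * y b \<le> \<alpha> * y b / M"
      using mult_right_mono[OF \<mu>M, of "y b"] b0 M0 by (simp add: field_simps)
    ultimately show ?thesis by (simp add: fB_def)
  qed
  have posY: "0 \<le> fY x" if "x \<in> Y" for x
  proof -
    have x: "g * \<alpha> \<le> y x" "y x \<le> \<alpha>" using Y[OF that] by auto
    then have x0: "0 \<le> y x" using g \<alpha> by (meson mult_nonneg_nonneg less_imp_le order_trans)
    \<comment> \<open>The same comparison with the line \<open>\<alpha> * y x / M\<close>, now with
      contact points 0 and \<alpha>.\<close>
    have "0 \<le> y x * ((\<alpha> - y x) * (M - \<alpha>)) / (\<alpha> * M)" using x x0 \<alpha> M0 by simp
    also have "\<dots> = y x - (y x)\<^sup>2 / \<alpha> + (y x)\<^sup>2 / M - \<alpha> * y x / M"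
      using \<alpha> M0 by (simp add: field_simps power2_eq_square)
    finally have "\<alpha> * y x / M \<le> y x - (y x)\<^sup>2 / \<alpha> + (y x)\<^sup>2 / M" by simp
    moreover have "\<mu> * y x \<le> \<alpha> * y x / M"
      using mult_right_mono[OF \<mu>M, of "y x"] x0 M0 by (simp add: field_simps)
    ultimately show ?thesis by (simp add: fY_def)
  qed
  \<comment> \<open>The centre is paid for by a leaf of weight \<open>M\<close> if \<open>B\<close>
    has one. Otherwise \<open>M = \<alpha>\<close>, and any leaf in \<open>Y\<close>
    suffices.\<close>
  have "\<mu> * \<alpha> \<le> sum fB B + sum fY Y"
  proof -
    consider x where "M = \<alpha>" "x \<in> Y" | b where "b \<in> B" "y b = M" using M by blast
    then show ?thesis
    proof cases
      case 1
      have "\<mu> * \<alpha> = (g - \<mu> * g) * \<alpha>" using \<mu>(3) by simp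
      also have "\<dots> = (1 - \<mu>) * (g * \<alpha>)" by (simp add: algebra_simps)
      finally have "\<mu> * \<alpha> = (1 - \<mu>) * (g * \<alpha>)" .
      also have "(1 - \<mu>) * (g * \<alpha>) \<le> (1 - \<mu>) * y x"
        using Y[OF 1(2)] \<mu> g by (intro mult_left_mono) auto
      also have "\<dots> = fY x" using 1(1) by (simp add: fY_def algebra_simps)
      also have "\<dots> \<le> sum fY Y" using fin 1(2) posY by (intro member_le_sum) auto
      finally show ?thesis using sum_nonneg[of B fB] posB by simp
    next
      case 2
      have "\<mu> * M = g * M / (1 + g)" by (simp add: \<mu>_def)
      also have "\<dots> \<le> \<alpha> / (1 + g)" using \<alpha>(3) g by (intro divide_right_mono) auto
      also have "\<dots> = \<alpha> - \<mu> * \<alpha>" using g by (simp add: \<mu>_def field_simps)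
      finally have "\<mu> * M \<le> \<alpha> - \<mu> * \<alpha>" .
      then have "\<mu> * \<alpha> \<le> fB b" using 2(2) by (simp add: fB_def)
      also have "\<dots> \<le> sum fB B" using fin 2(1) posB by (intro member_le_sum) auto
      finally show ?thesis using sum_nonneg[of Y fY] posY by simp
    qed
  qed
  then show ?thesis
    unfolding fB_def fY_def \<mu>_def[symmetric] sum_subtractf sum_distrib_left[symmetric] distrib_left
    by linarith
qed

section \<open>The exchange setting and the division of slack\<close>

text \<open>The graph enters only through \<open>nb u\<close>, which stands for N(u, A).
  Claw-freeness becomes the two degree bounds, and \<open>local_opt\<close> covers sets up to the
  largest size of a star. The parameter \<open>c\<close> stands for sqrt (1 - \<epsilon>).\<close>

locale exchange_setting =
  fixes Opt A :: "'a set" and nb :: "'a \<Rightarrow> 'a set" and w :: "'a \<Rightarrow> real" and \<pi> :: "'a \<Rightarrow> 'a"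
    and k :: nat and c :: real
  assumes fin_Opt: "finite Opt" and fin_A: "finite A"
    and nb_sub: "\<And>u. nb u \<subseteq> A"
    and pi_in: "\<And>u. u \<in> Opt \<Longrightarrow> \<pi> u \<in> nb u"
    and pi_max: "\<And>u x. u \<in> Opt \<Longrightarrow> x \<in> nb u \<Longrightarrow> w x \<le> w (\<pi> u)"
    and w_pos: "\<And>x. x \<in> A \<Longrightarrow> w x > 0"
    and deg_Opt: "\<And>u. u \<in> Opt \<Longrightarrow> card (nb u) \<le> k"
    and deg_A: "\<And>a. a \<in> A \<Longrightarrow> card {u \<in> Opt. a \<in> nb u} \<le> k"
    and local_opt: "\<And>X. X \<subseteq> A \<Longrightarrow> 1 \<le> card X \<Longrightarrow> card X \<le> 1 + k * (k - 1) \<Longrightarrow>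
      wt2 w (\<Union>x\<in>X. charged Opt \<pi> x)
        \<le> wt2 w (\<Union>x\<in>X. insert x (\<Union>u\<in>charged Opt \<pi> x. nb u - {x}))"
    and c_pos: "0 < c" and c_le: "c \<le> 1"
begin

abbreviation "C \<equiv> charged Opt \<pi>"

definition R :: "'a \<Rightarrow> 'a set" where
  "R a = {u \<in> Opt. a \<in> nb u}"

definition D :: "'a \<Rightarrow> real" where
  "D a = (\<Sum>u\<in>C a. (w u)\<^sup>2 - wt2 w (nb u - {a}))"

definition close :: "'a \<Rightarrow> 'a \<Rightarrow> bool" where
  "close u x \<longleftrightarrow> c\<^sup>2 * w (\<pi> u) \<le> w x"

definition down :: "'a \<Rightarrow> 'a \<Rightarrow> real" where
  "down u x = (if close u x then w x - (w x)\<^sup>2 / w (\<pi> u) else w x - (w x)\<^sup>2 / (c * w (\<pi> u)))"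

definition up :: "'a \<Rightarrow> 'a \<Rightarrow> real" where
  "up u x = (if close u x then 0 else (1 / c - 1) * (w x)\<^sup>2 / w (\<pi> u))"

text \<open>The share of \<open>2 * wt w Opt\<close> booked at \<open>a\<close>. Terms over
  \<open>C a\<close> come from the \<open>u\<close> with \<open>\<pi> u = a\<close>, the terms
  \<open>down\<close> from the other neighbours of \<open>a\<close> in \<open>Opt\<close>, and
  \<open>w a\<close> is counted once for each \<open>u\<close> in \<open>R a\<close>.\<close>

definition V :: "'a \<Rightarrow> real" where
  "V a = D a / w a - (\<Sum>u\<in>C a. (w u - w a)\<^sup>2 / w a + (\<Sum>x\<in>nb u - {a}. up u x))
    + real (card (R a)) * w a - (\<Sum>u\<in>R a - C a. down u a)"

lemma fin_nb: "finite (nb u)"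
  using nb_sub fin_A finite_subset by blast

lemma fin_C: "finite (C a)" and C_sub: "C a \<subseteq> Opt" and pi_C: "u \<in> C a \<Longrightarrow> \<pi> u = a"
  using fin_Opt by (auto simp: charged_def)

lemma C_sub_R: "C a \<subseteq> R a"
  using pi_in by (auto simp: charged_def R_def)

lemma fin_R: "finite (R a)" and card_R: "a \<in> A \<Longrightarrow> card (R a) \<le> k"
  using fin_Opt deg_A by (auto simp: R_def)

lemma C_disjoint: "x \<noteq> y \<Longrightarrow> C x \<inter> C y = {}"
  by (auto simp: charged_def)

section \<open>Local optimality applied to stars\<close>

text \<open>At most \<open>k\<close> vertices of \<open>Opt\<close> see \<open>a\<close>, and each
  of them sees at most \<open>k - 1\<close> further vertices of \<open>A\<close>. This is the source
  of the exchange size \<open>1 + k * (k - 1)\<close>.\<close>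

lemma star_card:
  assumes "a \<in> A" "L \<subseteq> (\<Union>u\<in>R a. nb u - {a})"
  shows "card (insert a L) \<le> 1 + k * (k - 1)"
proof -
  have "card L \<le> card (\<Union>u\<in>R a. nb u - {a})"
    using assms fin_R fin_nb by (intro card_mono) auto
  also have "\<dots> \<le> (\<Sum>u\<in>R a. card (nb u - {a}))"
    by (rule card_UN_le[OF fin_R])
  also have "\<dots> \<le> (\<Sum>u\<in>R a. k - 1)"
  proof (rule sum_mono)
    fix u assume "u \<in> R a"
    then show "card (nb u - {a}) \<le> k - 1"
      using deg_Opt[of u] fin_nb[of u] by (auto simp: R_def)
  qed
  also have "\<dots> \<le> k * (k - 1)"
    using card_R[OF assms(1)] by simp
  finally show ?thesis
    using card_insert_le_m1[of "1 + k * (k - 1)" L a] by simp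
qed

text \<open>Adding up the single exchanges would cost the squared weight of the whole star.
  Exchanged together, the vertices of \<open>Y\<close> already occur in the neighbourhoods of
  \<open>C a\<close> and cost nothing extra, and \<open>a\<close>, which occurs again in
  \<open>nbhd_plus\<close> of each \<open>b\<close> in \<open>B\<close>, is paid for only
  once.\<close>

lemma star_exchange:
  assumes a: "a \<in> A" and B: "B \<subseteq> A" "\<And>b. b \<in> B \<Longrightarrow> \<exists>u\<in>C b. a \<in> nb u"
    and Y: "Y \<subseteq> (\<Union>u\<in>C a. nb u)" and disj: "a \<notin> B" "a \<notin> Y" "B \<inter> Y = {}"
  shows "(\<Sum>x\<in>insert a (B \<union> Y). D x) \<le> (w a)\<^sup>2 + wt2 w B - real (card B) * (w a)\<^sup>2"
proof -
  let ?X = "insert a (B \<union> Y)"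
  let ?rest = "\<lambda>x. (\<Union>u\<in>C x. nb u - {x, a})"
  have YA: "Y \<subseteq> A" using Y nb_sub by blast
  have fin: "finite B" "finite Y" "finite ?X"
    using B(1) YA fin_A finite_subset by (auto intro: finite_subset)
  have "B \<subseteq> (\<Union>u\<in>R a. nb u - {a})"
    using B(2) disj(1) pi_in by (fastforce simp: R_def charged_def)
  moreover have "Y \<subseteq> (\<Union>u\<in>R a. nb u - {a})"
    using Y C_sub_R disj(2) by blast
  ultimately have "card ?X \<le> 1 + k * (k - 1)"
    using star_card[OF a] by simp
  moreover have "1 \<le> card ?X" using fin(3) card_gt_0_iff[of ?X] by fastforce
  ultimately have "wt2 w (\<Union>x\<in>?X. C x) \<le> wt2 w (\<Union>x\<in>?X. insert x (\<Union>u\<in>C x. nb u - {x}))"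
    using local_opt[of ?X] a B(1) YA by blast
  \<comment> \<open>\<open>Y\<close> is absorbed by the part of \<open>?rest\<close> that belongs to
    \<open>a\<close>, while \<open>a\<close> itself is taken out of all neighbourhoods and listed
    once.\<close>
  also have "\<dots> \<le> wt2 w (insert a (B \<union> (\<Union>x\<in>?X. ?rest x)))"
    using Y disj(2) fin fin_C fin_nb by (intro wt2_mono) auto
  also have "\<dots> \<le> wt2 w {a} + (wt2 w B + wt2 w (\<Union>x\<in>?X. ?rest x))"
  proof -
    have fin_rest: "finite (\<Union>x\<in>?X. ?rest x)" using fin fin_C fin_nb by blast
    have "wt2 w (insert a (B \<union> (\<Union>x\<in>?X. ?rest x)))
        \<le> wt2 w {a} + wt2 w (B \<union> (\<Union>x\<in>?X. ?rest x))"
      unfolding insert_is_Un[of a "B \<union> (\<Union>x\<in>?X. ?rest x)"]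
      using fin(1) fin_rest by (intro wt2_Un_le) blast+
    also have "\<dots> \<le> wt2 w {a} + (wt2 w B + wt2 w (\<Union>x\<in>?X. ?rest x))"
      by (intro add_left_mono wt2_Un_le fin(1) fin_rest)
    finally show ?thesis .
  qed
  also have "wt2 w (\<Union>x\<in>?X. ?rest x) \<le> (\<Sum>x\<in>?X. \<Sum>u\<in>C x. wt2 w (nb u - {x, a}))"
    using fin fin_C fin_nb
    by (intro order.trans[OF wt2_UN_le] sum_mono wt2_UN_le) auto
  \<comment> \<open>For \<open>x\<close> in \<open>B\<close> some \<open>u\<close> in
    \<open>C x\<close> sees \<open>a\<close>, so restoring \<open>a\<close> to the neighbourhoods
    adds at least one \<open>(w a)\<^sup>2\<close>.\<close>
  also have "\<dots> \<le> (\<Sum>x\<in>?X. (\<Sum>u\<in>C x. wt2 w (nb u - {x})) - (if x \<in> B then (w a)\<^sup>2 else 0))"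
  proof (rule sum_mono)
    fix x assume "x \<in> ?X"
    show "(\<Sum>u\<in>C x. wt2 w (nb u - {x, a}))
      \<le> (\<Sum>u\<in>C x. wt2 w (nb u - {x})) - (if x \<in> B then (w a)\<^sup>2 else 0)"
    proof (cases "x \<in> B")
      case True
      then obtain u where u: "u \<in> C x" "a \<in> nb u" using B(2) by blast
      have "a \<noteq> x" using True disj(1) by blast
      then have "nb u - {x} = insert a (nb u - {x, a})" using u(2) by blast
      then have "wt2 w (nb u - {x}) = (w a)\<^sup>2 + wt2 w (nb u - {x, a})"
        using fin_nb by (simp add: wt2_def)
      moreover have "(\<Sum>v\<in>C x - {u}. wt2 w (nb v - {x, a})) \<le> (\<Sum>v\<in>C x - {u}. wt2 w (nb v - {x}))"
        using fin_nb by (intro sum_mono wt2_mono) auto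
      ultimately show ?thesis
        using True u(1) by (simp add: sum.remove[OF fin_C u(1)])
    next
      case False
      then show ?thesis using fin_nb by (auto intro!: sum_mono wt2_mono)
    qed
  qed
  also have "\<dots> = (\<Sum>x\<in>?X. \<Sum>u\<in>C x. wt2 w (nb u - {x})) - real (card B) * (w a)\<^sup>2"
  proof -
    have "(\<Sum>x\<in>?X. if x \<in> B then (w a)\<^sup>2 else 0) = (\<Sum>x\<in>B. (w a)\<^sup>2)"
      using fin by (subst sum.inter_restrict[symmetric]) (simp_all add: Int_absorb1 subset_insertI2)
    then show ?thesis by (simp only: sum_subtractf sum_constant)
  qed
  finally have "wt2 w (\<Union>x\<in>?X. C x)
      \<le> (w a)\<^sup>2 + wt2 w B + (\<Sum>x\<in>?X. \<Sum>u\<in>C x. wt2 w (nb u - {x})) - real (card B) * (w a)\<^sup>2"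
    by (simp add: wt2_def)
  moreover have "wt2 w (\<Union>x\<in>?X. C x) = (\<Sum>x\<in>?X. \<Sum>u\<in>C x. (w u)\<^sup>2)"
    unfolding wt2_def using fin fin_C C_disjoint by (intro sum.UNION_disjoint) auto
  ultimately show ?thesis
    by (simp add: D_def sum_subtractf)
qed

lemma D_le: "a \<in> A \<Longrightarrow> D a \<le> (w a)\<^sup>2"
  using star_exchange[of a "{}" "{}"] by (simp add: wt2_def)

lemma slack_nonneg:
  assumes "u \<in> Opt" "x \<in> nb u"
  shows "0 \<le> up u x" "0 \<le> down u x"
    and "down u x + up u x = w x - (w x)\<^sup>2 / w (\<pi> u)"
proof -
  define p where "p = w (\<pi> u)"
  have x: "0 < w x" and p: "0 < p"
    using assms nb_sub pi_in w_pos unfolding p_def by blast+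
  have le: "w x \<le> p" using assms pi_max by (auto simp: p_def)
  \<comment> \<open>This keeps \<open>down\<close> nonnegative for pairs that are not close: there
    \<open>w x\<close> is below \<open>c\<^sup>2 * p\<close>, hence at most
    \<open>c * p\<close>.\<close>
  have c2: "c\<^sup>2 \<le> c" using c_pos c_le by (simp add: power2_eq_square mult_left_le)
  show "0 \<le> up u x" using c_pos c_le p by (simp add: up_def p_def)
  have "w x - (w x)\<^sup>2 / q = w x * (q - w x) / q" if "q > 0" for q
    using that by (simp add: field_simps power2_eq_square)
  note dec = this
  show "0 \<le> down u x"
  proof (cases "close u x")
    case True
    then show ?thesis using dec[OF p] x le p by (simp add: down_def p_def)
  next
    case False
    then have "w x \<le> c\<^sup>2 * p" by (simp add: close_def p_def)
    also have "\<dots> \<le> c * p" using c2 p by simp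
    finally show ?thesis using False dec[of "c * p"] x c_pos p by (simp add: down_def p_def)
  qed
  show "down u x + up u x = w x - (w x)\<^sup>2 / w (\<pi> u)"
    using c_pos p by (simp add: down_def up_def p_def field_simps)
qed

section \<open>Distributing the weight of the optimum over \<open>A\<close>\<close>

text \<open>With \<open>p = w (\<pi> u)\<close>, completing the square gives
  \<open>2 * w u = (w u)\<^sup>2 / p - (w u - p)\<^sup>2 / p + p\<close>. The last \<open>p\<close>
  is the weight of \<open>nb u\<close> minus that of the other neighbours, each of which splits into
  \<open>down\<close>, \<open>up\<close> and \<open>(w x)\<^sup>2 / p\<close>. Regrouping by
  vertices of \<open>A\<close> yields \<open>V\<close>.\<close>

lemma wt_Opt_eq: "2 * wt w Opt = (\<Sum>a\<in>A. V a)"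
proof -
  have pi_A: "\<pi> u \<in> A" if "u \<in> Opt" for u using that pi_in nb_sub by blast
  let ?f = "\<lambda>u. ((w u)\<^sup>2 - wt2 w (nb u - {\<pi> u}) - (w u - w (\<pi> u))\<^sup>2) / w (\<pi> u)
      - (\<Sum>x\<in>nb u - {\<pi> u}. up u x)"
  let ?s = "\<lambda>u. \<Sum>x\<in>nb u - {\<pi> u}. down u x"
  have each: "2 * w u = ?f u - ?s u + wt w (nb u)" if u: "u \<in> Opt" for u
  proof -
    have p: "w (\<pi> u) > 0" using pi_A[OF u] w_pos by blast
    have "?s u + (\<Sum>x\<in>nb u - {\<pi> u}. up u x) = (\<Sum>x\<in>nb u - {\<pi> u}. w x - (w x)\<^sup>2 / w (\<pi> u))"
      unfolding sum.distrib[symmetric] using slack_nonneg(3)[OF u] by (intro sum.cong) auto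
    also have "\<dots> = wt w (nb u) - w (\<pi> u) - wt2 w (nb u - {\<pi> u}) / w (\<pi> u)"
      using pi_in[OF u] fin_nb by (simp add: wt_def wt2_def sum_subtractf sum_divide_distrib sum.remove)
    finally show ?thesis using p by (simp add: field_simps power2_eq_square)
  qed
  have "(\<Sum>u\<in>Opt. ?f u) = (\<Sum>a\<in>A. \<Sum>u\<in>{u \<in> Opt. \<pi> u = a}. ?f u)"
    using fin_Opt fin_A pi_A by (intro sum.group[symmetric]) auto
  also have "\<dots> = (\<Sum>a\<in>A. D a / w a - (\<Sum>u\<in>C a. (w u - w a)\<^sup>2 / w a + (\<Sum>x\<in>nb u - {a}. up u x)))"
    unfolding D_def sum_divide_distrib sum_subtractf[symmetric] charged_def
    by (intro sum.cong) (auto simp: diff_divide_distrib)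
  finally have 1: "(\<Sum>u\<in>Opt. ?f u) = \<dots>" .
  have "(\<Sum>u\<in>Opt. wt w (nb u)) = (\<Sum>u\<in>Opt. \<Sum>a | a \<in> A \<and> a \<in> nb u. w a)"
    unfolding wt_def using nb_sub by (intro sum.cong) auto
  also have "\<dots> = (\<Sum>a\<in>A. \<Sum>u | u \<in> Opt \<and> a \<in> nb u. w a)"
    by (rule sum.swap_restrict[OF fin_Opt fin_A])
  finally have 2: "(\<Sum>u\<in>Opt. wt w (nb u)) = (\<Sum>a\<in>A. real (card (R a)) * w a)"
    by (simp add: R_def)
  have "(\<Sum>u\<in>Opt. ?s u) = (\<Sum>u\<in>Opt. \<Sum>a | a \<in> A \<and> (a \<in> nb u \<and> a \<noteq> \<pi> u). down u a)"
    using nb_sub by (intro sum.cong) auto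
  also have "\<dots> = (\<Sum>a\<in>A. \<Sum>u | u \<in> Opt \<and> (a \<in> nb u \<and> a \<noteq> \<pi> u). down u a)"
    by (rule sum.swap_restrict[OF fin_Opt fin_A])
  also have "\<dots> = (\<Sum>a\<in>A. \<Sum>u\<in>R a - C a. down u a)"
    by (intro sum.cong) (auto simp: R_def charged_def)
  finally have 3: "(\<Sum>u\<in>Opt. ?s u) = (\<Sum>a\<in>A. \<Sum>u\<in>R a - C a. down u a)" .
  have "2 * wt w Opt = (\<Sum>u\<in>Opt. ?f u - ?s u + wt w (nb u))"
    unfolding wt_def[of w Opt] sum_distrib_left by (rule sum.cong) (simp_all only: each)
  also have "\<dots> = (\<Sum>u\<in>Opt. ?f u) - (\<Sum>u\<in>Opt. ?s u) + (\<Sum>u\<in>Opt. wt w (nb u))"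
    by (simp only: sum.distrib sum_subtractf)
  also have "\<dots> = (\<Sum>a\<in>A. V a)"
    unfolding 1 2 3 V_def by (simp only: sum.distrib sum_subtractf)
  finally show ?thesis .
qed

section \<open>Bounding the shares\<close>

text \<open>Each \<open>u\<close> in \<open>R a\<close>, whether in \<open>C a\<close> or not,
  lowers the share by at least \<open>(1 - c) * w a\<close>. The threshold \<open>c\<^sup>2\<close>
  in \<open>close\<close> and the factor \<open>c\<close> in \<open>down\<close> make the two kinds
  agree.\<close>

lemma V_isolated:
  assumes a: "a \<in> A"
    and far1: "\<And>u x. u \<in> C a \<Longrightarrow> x \<in> nb u - {a} \<Longrightarrow> \<not> close u x"
    and far2: "\<And>u. u \<in> R a - C a \<Longrightarrow> \<not> close u a"
  shows "V a \<le> (k * c + 1 / c) * w a"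
proof -
  define \<alpha> where "\<alpha> = w a"
  have \<alpha>: "\<alpha> > 0" using a w_pos by (simp add: \<alpha>_def)
  define Z where "Z = (\<Sum>u\<in>C a. wt2 w (nb u - {a}))"
  define S where "S = (\<Sum>u\<in>C a. (w u)\<^sup>2)"
  have D: "D a = S - Z" by (simp add: D_def S_def Z_def sum_subtractf)
  have SZ: "S - \<alpha>\<^sup>2 \<le> Z" using D_le[OF a] by (simp add: D \<alpha>_def)
  have "(\<Sum>u\<in>C a. (w u - w a)\<^sup>2 / w a + (\<Sum>x\<in>nb u - {a}. up u x))
      = (\<Sum>u\<in>C a. (w u - \<alpha>)\<^sup>2 / \<alpha>) + (1 / c - 1) * Z / \<alpha>"
  proof -
    have "(\<Sum>x\<in>nb u - {a}. up u x) = (1 / c - 1) / \<alpha> * wt2 w (nb u - {a})" if "u \<in> C a" for u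
      unfolding wt2_def sum_distrib_left
      using far1[OF that] pi_C[OF that] by (intro sum.cong) (auto simp: up_def \<alpha>_def)
    then have "(\<Sum>u\<in>C a. \<Sum>x\<in>nb u - {a}. up u x) = (1 / c - 1) / \<alpha> * Z"
      unfolding Z_def sum_distrib_left by (intro sum.cong) auto
    then show ?thesis by (simp add: sum.distrib \<alpha>_def)
  qed
  moreover have "(\<Sum>u\<in>R a - C a. down u a) \<ge> (\<Sum>u\<in>R a - C a. \<alpha> * (1 - c))"
  proof (rule sum_mono)
    fix u assume u: "u \<in> R a - C a"
    define p where "p = w (\<pi> u)"
    have p: "p > 0" using u pi_in nb_sub w_pos by (auto simp: R_def p_def)
    have "\<alpha> \<le> c\<^sup>2 * p" using far2[OF u] by (simp add: close_def p_def \<alpha>_def)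
    then have "\<alpha> * \<alpha> \<le> \<alpha> * (c\<^sup>2 * p)" using \<alpha> by simp
    then have "\<alpha>\<^sup>2 / (c * p) \<le> \<alpha> * c"
      using c_pos p by (simp add: field_simps power2_eq_square)
    then show "\<alpha> * (1 - c) \<le> down u a"
      using far2[OF u] by (simp add: down_def \<alpha>_def p_def algebra_simps)
  qed
  moreover have "real (card (R a - C a)) = real (card (R a)) - real (card (C a))"
    using fin_R[of a] C_sub_R[of a] fin_C[of a] by (simp add: card_Diff_subset card_mono of_nat_diff)
  then have "(\<Sum>u\<in>R a - C a. \<alpha> * (1 - c)) = (real (card (R a)) - real (card (C a))) * (\<alpha> * (1 - c))"
    by (simp only: sum_constant)
  \<comment> \<open>The \<open>up\<close> terms raise the coefficient of \<open>Z\<close> to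
    \<open>1 / (c * \<alpha>)\<close>. Replacing \<open>Z\<close> by its lower bound from
    \<open>D_le\<close> leaves a sum over \<open>C a\<close> that is bounded termwise by the square
    of \<open>w u - c * \<alpha>\<close>.\<close>
  moreover have "S / \<alpha> - Z / \<alpha> - ((\<Sum>u\<in>C a. (w u - \<alpha>)\<^sup>2 / \<alpha>) + (1 / c - 1) * Z / \<alpha>)
      \<le> real (card (C a)) * (c * \<alpha> - \<alpha>) + \<alpha> / c"
  proof -
    have "S / \<alpha> - Z / \<alpha> - ((\<Sum>u\<in>C a. (w u - \<alpha>)\<^sup>2 / \<alpha>) + (1 / c - 1) * Z / \<alpha>)
        = S / \<alpha> - (\<Sum>u\<in>C a. (w u - \<alpha>)\<^sup>2 / \<alpha>) - Z / (c * \<alpha>)"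
      using \<alpha> c_pos by (simp add: field_simps)
    also have "\<dots> \<le> S / \<alpha> - (\<Sum>u\<in>C a. (w u - \<alpha>)\<^sup>2 / \<alpha>) - (S - \<alpha>\<^sup>2) / (c * \<alpha>)"
      using divide_right_mono[OF SZ, of "c * \<alpha>"] \<alpha> c_pos by simp
    also have "\<dots> = (\<Sum>u\<in>C a. (w u)\<^sup>2 / \<alpha> - (w u - \<alpha>)\<^sup>2 / \<alpha> - (w u)\<^sup>2 / (c * \<alpha>)) + \<alpha> / c"
      using \<alpha> c_pos
      by (simp add: S_def sum_subtractf sum_divide_distrib diff_divide_distrib power2_eq_square)
    also have "(\<Sum>u\<in>C a. (w u)\<^sup>2 / \<alpha> - (w u - \<alpha>)\<^sup>2 / \<alpha> - (w u)\<^sup>2 / (c * \<alpha>)) \<le> (\<Sum>u\<in>C a. c * \<alpha> - \<alpha>)"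
    proof (rule sum_mono)
      fix u
      have "0 \<le> (w u - c * \<alpha>)\<^sup>2 / (c * \<alpha>)" using \<alpha> c_pos by simp
      also have "\<dots> = c * \<alpha> - \<alpha> - ((w u)\<^sup>2 / \<alpha> - (w u - \<alpha>)\<^sup>2 / \<alpha> - (w u)\<^sup>2 / (c * \<alpha>))"
        using \<alpha> c_pos by (simp add: field_simps power2_eq_square)
      finally show "(w u)\<^sup>2 / \<alpha> - (w u - \<alpha>)\<^sup>2 / \<alpha> - (w u)\<^sup>2 / (c * \<alpha>) \<le> c * \<alpha> - \<alpha>" by simp
    qed
    finally show ?thesis by simp
  qed
  ultimately have "V a \<le> real (card (C a)) * (c * \<alpha> - \<alpha>) + \<alpha> / c + real (card (R a)) * \<alpha>
      - (real (card (R a)) - real (card (C a))) * (\<alpha> * (1 - c))"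
    unfolding V_def D \<alpha>_def[symmetric] diff_divide_distrib by linarith
  also have "\<dots> = \<alpha> / c + real (card (R a)) * (c * \<alpha>)"
    by (simp add: algebra_simps)
  also have "real (card (R a)) * (c * \<alpha>) \<le> real k * (c * \<alpha>)"
    using card_R[OF a] \<alpha> c_pos by (intro mult_right_mono) auto
  finally show ?thesis by (simp add: \<alpha>_def algebra_simps)
qed

lemma V_le:
  assumes a: "a \<in> A" and T: "T \<subseteq> R a - C a"
  shows "V a \<le> D a / w a + k * w a - (\<Sum>u\<in>T. down u a)"
proof -
  have "0 \<le> (\<Sum>u\<in>C a. (w u - w a)\<^sup>2 / w a + (\<Sum>x\<in>nb u - {a}. up u x))"
    using w_pos[OF a] slack_nonneg(1) C_sub
    by (intro sum_nonneg add_nonneg_nonneg) (auto simp: subset_iff)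
  moreover have "(\<Sum>u\<in>T. down u a) \<le> (\<Sum>u\<in>R a - C a. down u a)"
    using T fin_R by (intro sum_mono2) (auto intro: slack_nonneg(2) simp: R_def)
  moreover have "real (card (R a)) * w a \<le> k * w a"
    using card_R[OF a] w_pos[OF a] by (intro mult_right_mono) auto
  ultimately show ?thesis unfolding V_def by linarith
qed

text \<open>\<open>star_exchange\<close> bounds the sum of \<open>D\<close>, whereas the shares
  contain \<open>D x / w x\<close>. Passing to the common denominator \<open>M\<close> connects the
  two, and \<open>star_slack_lower\<close> with \<open>g = c\<^sup>2\<close> evaluates the
  result.\<close>

lemma V_star:
  assumes a: "a \<in> A" and B: "B \<subseteq> A" "\<And>b. b \<in> B \<Longrightarrow> \<exists>u\<in>C b. a \<in> nb u \<and> close u a"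
    and Y: "\<And>y. y \<in> Y \<Longrightarrow> \<exists>u\<in>C a. y \<in> nb u \<and> close u y"
    and disj: "a \<notin> B" "a \<notin> Y" "B \<inter> Y = {}" and ne: "B \<union> Y \<noteq> {}"
  shows "(\<Sum>x\<in>insert a (B \<union> Y). V x) \<le> (real k + 1 - c\<^sup>2 / (1 + c\<^sup>2)) * wt w (insert a (B \<union> Y))"
proof -
  let ?X = "insert a (B \<union> Y)"
  define \<alpha> where "\<alpha> = w a"
  have \<alpha>: "\<alpha> > 0" using a w_pos by (simp add: \<alpha>_def)
  have YA: "Y \<subseteq> A" using Y nb_sub by blast
  have XA: "?X \<subseteq> A" using a B(1) YA by blast
  have fin: "finite B" "finite Y" using B(1) YA fin_A finite_subset by blast+
  from B(2) obtain v where v: "\<And>b. b \<in> B \<Longrightarrow> v b \<in> C b \<and> a \<in> nb (v b) \<and> close (v b) a"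
    by metis
  from Y obtain u where u: "\<And>y. y \<in> Y \<Longrightarrow> u y \<in> C a \<and> y \<in> nb (u y) \<and> close (u y) y"
    by metis
  have wB: "\<alpha> \<le> w b \<and> c\<^sup>2 * w b \<le> \<alpha>" if "b \<in> B" for b
    using v[OF that] pi_C[of "v b" b] pi_max[of "v b" a] C_sub[of b]
    by (auto simp: close_def \<alpha>_def)
  have wY: "c\<^sup>2 * \<alpha> \<le> w y \<and> w y \<le> \<alpha>" if "y \<in> Y" for y
    using u[OF that] pi_C[of "u y" a] pi_max[of "u y" y] C_sub[of a]
    by (auto simp: close_def \<alpha>_def)
  have c2: "0 < c\<^sup>2" "c\<^sup>2 \<le> 1" using c_pos c_le by (auto simp: power_le_one)
  obtain M where M: "\<And>x. x \<in> B \<Longrightarrow> w x \<le> M" "\<alpha> \<le> M" "c\<^sup>2 * M \<le> \<alpha>"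
    "(M = \<alpha> \<and> Y \<noteq> {}) \<or> (\<exists>b\<in>B. w b = M)"
  proof (cases "B = {}")
    case True
    then show ?thesis using that[of \<alpha>] ne c2 \<alpha> by auto
  next
    case False
    then have "Max (w ` B) \<in> w ` B" using fin by simp
    then obtain b where b: "b \<in> B" "w b = Max (w ` B)" by force
    then have "w x \<le> w b" if "x \<in> B" for x using that fin by simp
    then show ?thesis using b(1) wB by (intro that[of "w b"]) auto
  qed
  have M0: "M > 0" using M(2) \<alpha> by linarith
  \<comment> \<open>Since \<open>(w x)\<^sup>2 - D x\<close> is nonnegative by \<open>D_le\<close>,
    dividing it by the larger \<open>M\<close> instead of \<open>w x\<close> only weakens the
    bound.\<close>
  have Dle: "D x / w x \<le> w x - ((w x)\<^sup>2 - D x) / M" if "x \<in> ?X" for x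
  proof -
    have x: "w x > 0" "D x \<le> (w x)\<^sup>2" using that XA w_pos D_le by auto
    have "w x \<le> M" using that M(1,2) wY by (force simp: \<alpha>_def)
    then have "((w x)\<^sup>2 - D x) / M \<le> ((w x)\<^sup>2 - D x) / w x"
      using x by (intro divide_left_mono) auto
    then show ?thesis using x by (simp add: diff_divide_distrib power2_eq_square)
  qed
  have "(\<Sum>x\<in>?X. D x / w x) \<le> wt w ?X - (wt2 w ?X - (\<Sum>x\<in>?X. D x)) / M"
    using sum_mono[OF Dle, of ?X]
    by (simp add: wt_def wt2_def sum_subtractf sum_divide_distrib diff_divide_distrib)
  also have "\<dots> \<le> wt w ?X - (real (card B) * \<alpha>\<^sup>2 + wt2 w Y) / M"
  proof -
    have "(\<Sum>x\<in>?X. D x) \<le> (w a)\<^sup>2 + wt2 w B - real (card B) * (w a)\<^sup>2"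
      using a B Y disj by (intro star_exchange) blast+
    moreover have "wt2 w ?X = (w a)\<^sup>2 + wt2 w B + wt2 w Y"
      using fin disj by (simp add: wt2_def sum.union_disjoint)
    ultimately show ?thesis using M0 by (simp add: divide_right_mono \<alpha>_def)
  qed
  finally have Dsum: "(\<Sum>x\<in>?X. D x / w x) \<le> wt w ?X - (real (card B) * \<alpha>\<^sup>2 + wt2 w Y) / M" .
  have Va: "V a \<le> D a / w a + k * w a - (\<Sum>b\<in>B. \<alpha> - \<alpha>\<^sup>2 / w b)"
  proof -
    have piv: "\<pi> (v b) = b" if "b \<in> B" for b using v[OF that] pi_C by blast
    have "v b \<in> R a - C a" if b: "b \<in> B" for b
    proof -
      have "v b \<in> C b" "a \<in> nb (v b)" "b \<noteq> a" using v[OF b] b disj(1) by auto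
      then show ?thesis by (auto simp: charged_def R_def)
    qed
    then have "v ` B \<subseteq> R a - C a" by blast
    then have Vv: "V a \<le> D a / w a + k * w a - (\<Sum>u\<in>v ` B. down u a)" by (rule V_le[OF a])
    \<comment> \<open>Distinct leaves \<open>b\<close> have distinct witnesses because
      \<open>\<pi> (v b) = b\<close>, so the slacks of \<open>a\<close> really add up.\<close>
    have "inj_on v B" using piv by (metis inj_onI)
    then have "(\<Sum>u\<in>v ` B. down u a) = (\<Sum>b\<in>B. down (v b) a)" by (simp add: sum.reindex)
    also have "\<dots> = (\<Sum>b\<in>B. \<alpha> - \<alpha>\<^sup>2 / w b)"
      using v piv by (intro sum.cong) (auto simp: down_def \<alpha>_def)
    finally show ?thesis using Vv by simp
  qed
  have VB: "V b \<le> D b / w b + k * w b" if "b \<in> B" for b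
    using V_le[of b "{}"] that B(1) by auto
  have VY: "V y \<le> D y / w y + k * w y - (w y - (w y)\<^sup>2 / \<alpha>)" if y: "y \<in> Y" for y
  proof -
    have "u y \<in> C a" "y \<in> nb (u y)" "close (u y) y" using u[OF y] by auto
    moreover from this have "{u y} \<subseteq> R y - C y"
      using y disj(2) by (auto simp: charged_def R_def)
    ultimately show ?thesis
      using V_le[of y "{u y}"] y YA pi_C[of "u y" a] by (auto simp: down_def \<alpha>_def)
  qed
  have sum_VB: "(\<Sum>b\<in>B. V b) \<le> (\<Sum>b\<in>B. D b / w b + k * w b)"
    by (rule sum_mono[OF VB])
  have sum_VY: "(\<Sum>y\<in>Y. V y) \<le> (\<Sum>y\<in>Y. D y / w y + k * w y - (w y - (w y)\<^sup>2 / \<alpha>))"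
    by (rule sum_mono[OF VY])
  have split: "(\<Sum>x\<in>?X. f x) = f a + (\<Sum>b\<in>B. f b) + (\<Sum>y\<in>Y. f y)" for f :: "'a \<Rightarrow> real"
    using fin disj by (simp add: sum.union_disjoint)
  have "(\<Sum>x\<in>?X. V x) \<le> (\<Sum>x\<in>?X. D x / w x) + k * wt w ?X
      - (\<Sum>b\<in>B. \<alpha> - \<alpha>\<^sup>2 / w b) - (\<Sum>y\<in>Y. w y - (w y)\<^sup>2 / \<alpha>)"
    using Va sum_VB sum_VY
    unfolding split wt_def sum.distrib sum_subtractf sum_distrib_left[symmetric] distrib_left
    by linarith
  also have "\<dots> \<le> (real k + 1) * wt w ?X - ((\<Sum>b\<in>B. \<alpha> - \<alpha>\<^sup>2 / w b + \<alpha>\<^sup>2 / M)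
      + (\<Sum>y\<in>Y. w y - (w y)\<^sup>2 / \<alpha> + (w y)\<^sup>2 / M))"
    using Dsum
    unfolding sum.distrib sum_constant wt2_def sum_divide_distrib[symmetric] add_divide_distrib
      distrib_right by (simp add: distrib_right)
  also have "\<dots> \<le> (real k + 1) * wt w ?X - c\<^sup>2 / (1 + c\<^sup>2) * (\<alpha> + (\<Sum>b\<in>B. w b) + (\<Sum>y\<in>Y. w y))"
    using star_slack_lower[OF c2 \<alpha> M(2,3) fin, of w] wB wY M(1,4) by auto
  also have "\<dots> = (real k + 1 - c\<^sup>2 / (1 + c\<^sup>2)) * wt w ?X"
    unfolding wt_def split \<alpha>_def by (simp add: algebra_simps)
  finally show ?thesis .
qed

section \<open>Combining stars and isolated vertices\<close>

definition linked :: "'a \<Rightarrow> 'a \<Rightarrow> bool" where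
  "linked a b \<longleftrightarrow> a \<in> A \<and> b \<in> A \<and> a \<noteq> b \<and>
    ((\<exists>u\<in>C a. b \<in> nb u \<and> close u b) \<or> (\<exists>u\<in>C b. a \<in> nb u \<and> close u a))"

lemma wt_Opt_bound:
  assumes \<mu>: "\<mu> \<le> c\<^sup>2 / (1 + c\<^sup>2)" "\<mu> \<le> (real k - 1 / c) * (1 - c)"
  shows "2 * wt w Opt \<le> (real k + 1 - \<mu>) * wt w A"
proof -
  define L where "L = {a \<in> A. \<exists>b\<in>A. linked a b}"
  have LA: "L \<subseteq> A" "finite L" using fin_A by (auto simp: L_def)
  have sym: "linked a b \<Longrightarrow> linked b a" for a b by (auto simp: linked_def)
  have irr: "\<not> linked a a" for a by (auto simp: linked_def)
  have "\<exists>b\<in>L. linked a b" if "a \<in> L" for a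
    using that sym unfolding L_def by blast
  then obtain P where P: "\<forall>X\<in>P. is_star linked X" "disjoint P" "\<Union>P = L"
    using star_partition[of L linked] LA sym irr by metis
  have star: "sum V X \<le> (real k + 1 - \<mu>) * wt w X" if XP: "X \<in> P" for X
  proof -
    obtain a N where X: "X = insert a N" "a \<notin> N" "N \<noteq> {}" "\<forall>x\<in>N. linked a x"
      using bspec[OF P(1) XP] unfolding is_star_def by (elim exE conjE)
    define Y where "Y = {y \<in> N. \<exists>u\<in>C a. y \<in> nb u \<and> close u y}"
    \<comment> \<open>A leaf linked to \<open>a\<close> in both directions is put into
      \<open>Y\<close>. The others must be linked through their own \<open>C b\<close>.\<close>
    define B where "B = N - Y"
    have N: "N = B \<union> Y" "B \<inter> Y = {}" by (auto simp: B_def Y_def)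
    have "a \<in> A" "N \<subseteq> A" using X(3,4) by (auto simp: linked_def)
    then have XA: "X \<subseteq> A" using X(1) by blast
    have "sum V (insert a (B \<union> Y)) \<le> (real k + 1 - c\<^sup>2 / (1 + c\<^sup>2)) * wt w (insert a (B \<union> Y))"
    proof (rule V_star)
      show "\<exists>u\<in>C b. a \<in> nb u \<and> close u a" if "b \<in> B" for b
        using that X(4) by (auto simp: B_def Y_def linked_def)
      show "\<exists>u\<in>C a. y \<in> nb u \<and> close u y" if "y \<in> Y" for y
        using that by (simp add: Y_def)
    qed (use X(2,3) \<open>a \<in> A\<close> \<open>N \<subseteq> A\<close> N in blast)+
    then have "sum V X \<le> (real k + 1 - c\<^sup>2 / (1 + c\<^sup>2)) * wt w X" using X(1) N(1) by simp
    moreover have "0 \<le> wt w X"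
      unfolding wt_def using XA w_pos by (intro sum_nonneg) (meson less_imp_le subsetD)
    then have "(real k + 1 - c\<^sup>2 / (1 + c\<^sup>2)) * wt w X \<le> (real k + 1 - \<mu>) * wt w X"
      using \<mu>(1) by (intro mult_right_mono) auto
    ultimately show ?thesis by linarith
  qed
  have finP: "finite X" if "X \<in> P" for X
    using that P(3) by (intro finite_subset[OF _ LA(2)]) blast
  have UP: "sum f L = (\<Sum>X\<in>P. sum f X)" for f :: "'a \<Rightarrow> real"
  proof -
    have "\<forall>X\<in>P. \<forall>Z\<in>P. X \<noteq> Z \<longrightarrow> X \<inter> Z = {}" using P(2) by (simp add: disjoint_def)
    with finP show ?thesis unfolding P(3)[symmetric] by (subst sum.Union_disjoint) auto
  qed
  have "sum V L = (\<Sum>X\<in>P. sum V X)" by (rule UP)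
  also have "\<dots> \<le> (\<Sum>X\<in>P. (real k + 1 - \<mu>) * wt w X)" by (rule sum_mono[OF star])
  also have "\<dots> = (real k + 1 - \<mu>) * wt w L"
    unfolding wt_def UP[of w] by (simp add: sum_distrib_left)
  finally have sumL: "sum V L \<le> (real k + 1 - \<mu>) * wt w L" .
  have "V a \<le> (real k + 1 - \<mu>) * w a" if a: "a \<in> A - L" for a
  proof -
    have nl: "\<not> linked a b" for b using a unfolding L_def linked_def by blast
    have "V a \<le> (k * c + 1 / c) * w a"
    proof (rule V_isolated)
      show "a \<in> A" using a by blast
      show "\<not> close u x" if "u \<in> C a" "x \<in> nb u - {a}" for u x
        using nl[of x] that a nb_sub unfolding linked_def by blast
      show "\<not> close u a" if "u \<in> R a - C a" for u
      proof
        assume cl: "close u a"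
        have u: "u \<in> Opt" "a \<in> nb u" "\<pi> u \<noteq> a" using that by (auto simp: R_def charged_def)
        moreover have "u \<in> C (\<pi> u)" using u(1) by (simp add: charged_def)
        moreover have "\<pi> u \<in> A" using pi_in[OF u(1)] nb_sub by blast
        ultimately have "linked a (\<pi> u)" using cl a unfolding linked_def by blast
        with nl show False by blast
      qed
    qed
    also have "k * c + 1 / c = k + 1 - (real k - 1 / c) * (1 - c)"
      using c_pos by (simp add: field_simps)
    also have "\<dots> * w a \<le> (real k + 1 - \<mu>) * w a"
      using \<mu>(2) a w_pos[of a] by (intro mult_right_mono) auto
    finally show ?thesis .
  qed
  then have "sum V (A - L) \<le> (\<Sum>a\<in>A - L. (real k + 1 - \<mu>) * w a)" by (rule sum_mono)
  also have "\<dots> = (real k + 1 - \<mu>) * wt w (A - L)" by (simp add: wt_def sum_distrib_left)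
  finally have "sum V (A - L) \<le> (real k + 1 - \<mu>) * wt w (A - L)" .
  moreover have "sum f A = sum f (A - L) + sum f L" for f :: "'a \<Rightarrow> real"
    using LA(1) fin_A by (rule sum.subset_diff)
  ultimately show ?thesis
    unfolding wt_Opt_eq using sumL by (simp add: wt_def algebra_simps)
qed

end

section \<open>Degree bounds from claw-freeness\<close>

lemma claw_free_card_le:
  assumes "graph G" "claw_free (k + 1) G" "v \<in> verts G" "finite T"
    "\<And>t. t \<in> T \<Longrightarrow> v \<rightarrow>\<^bsub>G\<^esub> t" "pairwise_nonadj G T"
  shows "card T \<le> k"
proof (rule ccontr)
  assume "\<not> card T \<le> k"
  then obtain S where "S \<subseteq> T" "card S = k + 1" "finite S"
    using obtain_subset_with_card_n[of "k + 1" T] by auto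
  moreover from this have "pairwise_nonadj G S"
    using assms(6) by (auto simp: pairwise_nonadj_def)
  ultimately show False
    using assms unfolding claw_free_iff[OF assms(1)] by blast
qed

text \<open>A vertex of \<open>S\<close> has only itself as neighbour in \<open>S\<close>, and
  \<open>k \<ge> 1\<close> covers this case. For any other \<open>v\<close> the neighbours in
  \<open>S\<close> are the talons of a claw at \<open>v\<close>.\<close>

lemma nbhd_singleton_card_le:
  assumes "graph G" "claw_free (k + 1) G" "k \<ge> 1" "v \<in> verts G" "indep_set G S"
  shows "card (nbhd G {v} S) \<le> k"
proof (cases "v \<in> S")
  case True
  interpret graph G by fact
  have "nbhd G {v} S = {v}"
    using True assms(5) adj_not_same
    by (auto simp: nbhd_def indep_set_def pairwise_nonadj_def)
  then show ?thesis using assms(3) by simp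
next
  case False
  interpret graph G by fact
  have "nbhd G {v} S = {y \<in> S. v \<rightarrow>\<^bsub>G\<^esub> y}" using False by (auto simp: nbhd_def)
  moreover have "finite S" using assms(5) finite_subset[OF _ finite_verts] by (auto simp: indep_set_def)
  moreover have "pairwise_nonadj G {y \<in> S. v \<rightarrow>\<^bsub>G\<^esub> y}"
    using assms(5) by (auto simp: indep_set_def pairwise_nonadj_def)
  ultimately show ?thesis
    by (auto intro!: claw_free_card_le[OF assms(1,2,4)])
qed

theorem theorem2:
  fixes G :: "('a, 'b) pre_digraph"
    and w :: "'a \<Rightarrow> real"
    and Opt A :: "'a set"
    and \<pi> :: "'a \<Rightarrow> 'a"
    and k s :: nat
    and \<epsilon> :: real
  assumes "k \<ge> 1"
    and "graph G"
    and "claw_free (k + 1) G"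
    and "\<forall>v\<in>verts G. w v > 0"
    and "max_weight_indep_set G w Opt"
    and "indep_set G A"
    and "\<forall>u\<in>Opt. nbhd G {u} A \<noteq> {}"
    and "heaviest_nbr_map G w Opt A \<pi>"
    and "0 \<le> \<epsilon>" and "\<epsilon> \<le> 1 / 2"
    and "s \<ge> 1 + k * (k - 1)"
    and "locally_optimal G w Opt \<pi> s A"
  shows "wt w Opt \<le>
    ((real k + 1) / 2 - 1 / 2 * min ((1 - \<epsilon>) / (2 - \<epsilon>)) (rho k \<epsilon>)) * wt w A"
proof -
  interpret graph G by fact
  have Opt: "indep_set G Opt"
    using assms(5) by (simp add: max_weight_indep_set_def is_arg_max_def)
  then have V: "Opt \<subseteq> verts G" "A \<subseteq> verts G"
    using assms(6) by (auto simp: indep_set_def)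
  have fin: "finite Opt" "finite A" using V by (auto intro: finite_subset[OF _ finite_verts])
  have pi: "is_arg_max w (\<lambda>a. a \<in> nbhd G {u} A) (\<pi> u)" if "u \<in> Opt" for u
    using assms(8) that by (simp add: heaviest_nbr_map_def)
  define c where "c = sqrt (1 - \<epsilon>)"
  have c: "0 < c" "c \<le> 1" "c\<^sup>2 = 1 - \<epsilon>" using assms(9,10) by (auto simp: c_def)
  have nb_plus: "nbhd_plus G Opt A \<pi> x = insert x (\<Union>u\<in>charged Opt \<pi> x. nbhd G {u} A - {x})" for x
    by (auto simp: nbhd_plus_def nbhd_def)
  interpret exchange_setting Opt A "\<lambda>u. nbhd G {u} A" w \<pi> k c
  proof
    show "card (nbhd G {u} A) \<le> k" if "u \<in> Opt" for u
      using nbhd_singleton_card_le[OF assms(2,3,1) _ assms(6)] that V(1) by blast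
    show "card {u \<in> Opt. a \<in> nbhd G {u} A} \<le> k" if "a \<in> A" for a
    proof -
      \<comment> \<open>By symmetry of adjacency the claw is now centred at \<open>a\<close>, with
        talons in the independent set \<open>Opt\<close>.\<close>
      have "{u \<in> Opt. a \<in> nbhd G {u} A} = nbhd G {a} Opt"
        using that sym_arcs by (auto simp: nbhd_def symmetric_def dest: symD)
      then show ?thesis
        using nbhd_singleton_card_le[OF assms(2,3,1) _ Opt] that V(2) by auto
    qed
    show "wt2 w (\<Union>x\<in>X. charged Opt \<pi> x)
        \<le> wt2 w (\<Union>x\<in>X. insert x (\<Union>u\<in>charged Opt \<pi> x. nbhd G {u} A - {x}))"
      if "X \<subseteq> A" "1 \<le> card X" "card X \<le> 1 + k * (k - 1)" for X
      using assms(11,12) that unfolding locally_optimal_def nb_plus by auto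
    show "w x \<le> w (\<pi> u)" if "u \<in> Opt" "x \<in> nbhd G {u} A" for u x
      using pi[OF that(1)] that(2) by (auto simp: is_arg_max_linorder)
  qed (use fin pi V assms(4) c in \<open>auto simp: nbhd_def is_arg_max_def\<close>)
  have "2 * wt w Opt
      \<le> (real k + 1 - min ((1 - \<epsilon>) / (2 - \<epsilon>)) (rho k \<epsilon>)) * wt w A"
  proof (rule wt_Opt_bound)
    show "min ((1 - \<epsilon>) / (2 - \<epsilon>)) (rho k \<epsilon>) \<le> c\<^sup>2 / (1 + c\<^sup>2)"
      unfolding c(3) by simp
  qed (simp add: rho_def c_def)
  then show ?thesis by (simp add: field_simps)
qed

end
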